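(* Let $\mathbb{X}\subset\mathbb{R}^d$ be compact and consider a zero mean Gaussian process defined through a continuous covariance kernel $k(\cdot,\cdot)$ with Lipschitz constant $L_k$ on $\mathbb{X}$. Let $f:\mathbb{X}\to\mathbb{R}$ be a continuous unknown function with Lipschitz constant $L_f$ on $\mathbb{X}$, let $N\in\mathbb{N}$, and let $y_1,\dots,y_N$ be observations at inputs $\bm{x}_1,\dots,\bm{x}_N\in\mathbb{X}$, such that $f$ is a sample from the Gaussian process $\mathcal{GP}(0,k(\bm{x},\bm{x}'))$ and $y_i=f(\bm{x}_i)+\epsilon_i$ with i.i.d. zero mean Gaussian noise $\epsilon_i$ of variance $\sigma_n^2$. Then the posterior mean function $\nu_N(\cdot)$ and the posterior standard deviation $\sigma_N(\cdot)$ of the Gaussian process conditioned on the training data $\{(\bm{x}_i,y_i)\}_{i=1}^N$ are continuous with Lipschitz constant $L_{\nu_N}$ and modulus of continuity $\omega_{\sigma_N}(\cdot)$ on $\mathbb{X}$, respectively, such that $$L_{\nu_N}\le L_k\sqrt{N}\,\big\|(\bm{K}(\bm{X}_N,\bm{X}_N)+\sigma_n^2\bm{I}_N)^{-1}\bm{y}_N\big\|,$$ $$\omega_{\sigma_N}(\tau)\le\sqrt{2\tau L_k\Big(1+N\,\big\|(\bm{K}(\bm{X}_N,\bm{X}_N)+\sigma_n^2\bm{I}_N)^{-1}\big\|\max_{\bm{x},\bm{x}'\in\mathbb{X}}k(\bm{x},\bm{x}')\Big)}.$$ Moreover, for every $\delta\in(0,1)$ and $\tau\in\mathbb{R}_+$,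 setting $$\beta(\tau)=2\log\Big(\frac{M(\tau,\mathbb{X})}{\delta}\Big),\qquad \gamma(\tau)=(L_{\nu_N}+L_f)\tau+\sqrt{\beta(\tau)}\,\omega_{\sigma_N}(\tau),$$ it holds that $$P\Big(|f(\bm{x})-\nu_N(\bm{x})|\le\sqrt{\beta(\tau)}\,\sigma_N(\bm{x})+\gamma(\tau),\ \forall\bm{x}\in\mathbb{X}\Big)\ge 1-\delta.$$
   Context: Notation. $\mathbb{R}_+$ denotes the positive reals, $\|\cdot\|$ the Euclidean norm (and the induced matrix norm), $\bm{I}_N$ the $N\times N$ identity. Covariance kernels are functions $k:\mathbb{R}^d\times\mathbb{R}^d\to\mathbb{R}_+$, and $\sigma_n^2\ge0$. Gaussian process regression. $\bm{X}_N$ collects the input points $\bm{x}_1,\dots,\bm{x}_N$ and $\bm{y}_N=(y_1,\dots,y_N)^{\top}$. $\bm{K}(\bm{X}_N,\bm{X}_N)$ is the $N\times N$ matrix with entries $k(\bm{x}_i,\bm{x}_j)$; $\bm{k}(\bm{x},\bm{X}_N)$ is the row vector with entries $k(\bm{x},\bm{x}_i)$ and $\bm{k}(\bm{X}_N,\bm{x})$ its transpose. The matrix $\bm{K}(\bm{X}_N,\bm{X}_N)+\sigma_n^2\bm{I}_N$ is understood to be invertible. The posterior mean and variance are $$\nu_N(\bm{x})=\bm{k}(\bm{x},\bm{X}_N)(\bm{K}(\bm{X}_N,\bm{X}_N)+\sigma_n^2\bm{I}_N)^{-1}\bm{y}_N,$$ $$\sigma_N^2(\bm{x})=k(\bm{x},\bm{x})-\bm{k}(\bm{x},\bm{X}_N)(\bm{K}(\bm{X}_N,\bm{X}_N)+\sigma_n^2\bm{I}_N)^{-1}\bm{k}(\bm{X}_N,\bm{x}),$$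 and $\sigma_N(\bm{x})=\sqrt{\sigma_N^2(\bm{x})}$. The noise is independent of $f$; probability is with respect to the Gaussian process distribution of $f$ and the noise. $L_f$ is a Lipschitz constant of the realized function $f$. Lipschitz constant of the kernel: $|k(\bm{x},\bm{z})-k(\bm{x}',\bm{z})|\le L_k\|\bm{x}-\bm{x}'\|$ for all $\bm{x},\bm{x}',\bm{z}\in\mathbb{X}$; for a differentiable kernel it is taken to be $L_k=\max_{\bm{x},\bm{x}'\in\mathbb{X}}\big\|\big[\tfrac{\partial k(\bm{x},\bm{x}')}{\partial x_1},\dots,\tfrac{\partial k(\bm{x},\bm{x}')}{\partial x_d}\big]^{\top}\big\|$. A function $g$ admits a modulus of continuity $\omega:\mathbb{R}_+\to\mathbb{R}_+$ if $|g(\bm{x})-g(\bm{x}')|\le\omega(\|\bm{x}-\bm{x}'\|)$ for all $\bm{x},\bm{x}'$ in its domain. The $\tau$-covering number $M(\tau,\mathbb{X})$ is the minimum number of Euclidean balls of radius $\tau$ (with centers in $\mathbb{X}$) required to completely cover $\mathbb{X}$, i.e. the minimum number of points of a finite set $\mathbb{X}_\tau\subset\mathbb{X}$ with $\max_{\bm{x}\in\mathbb{X}}\min_{\bm{x}'\in\mathbb{X}_\tau}\|\bm{x}-\bm{x}'\|\le\tau$. *)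

theory Defs
  imports "HOL-Probability.Probability"
begin

(* Values are positive: kernels are maps into the positive reals. *)
definition covariance_kernel :: "('a \<Rightarrow> 'a \<Rightarrow> real) \<Rightarrow> bool" where
  "covariance_kernel k \<longleftrightarrow>
     (\<forall>x x'. 0 < k x x') \<and>
     (\<forall>x x'. k x x' = k x' x) \<and>
     (\<forall>T c. finite T \<longrightarrow> 0 \<le> (\<Sum>x\<in>T. \<Sum>x'\<in>T. c x * c x' * k x x'))"

(* Normal law with mean m and variance v \<ge> 0; for v = 0 it is the point mass at m, whereas the
   library's normal_density m 0 is the zero function. *)
definition gaussian :: "real \<Rightarrow> real \<Rightarrow> real measure" where
  "gaussian m v = (if 0 < v then density lborel (\<lambda>t. ennreal (normal_density m (sqrt v) t))
                   else return borel m)"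

(* Finite-dimensional distributions are multivariate normal: every finite linear combination is
   univariate normal (possibly degenerate), with the mean and variance dictated by m and k. *)
definition gaussian_process ::
  "'w measure \<Rightarrow> 'a set \<Rightarrow> ('a \<Rightarrow> real) \<Rightarrow> ('a \<Rightarrow> 'a \<Rightarrow> real) \<Rightarrow> ('a \<Rightarrow> 'w \<Rightarrow> real) \<Rightarrow> bool" where
  "gaussian_process M S m k f \<longleftrightarrow>
     (\<forall>x\<in>S. f x \<in> borel_measurable M) \<and>
     (\<forall>T c. finite T \<and> T \<subseteq> S \<longrightarrow>
        distr M borel (\<lambda>\<omega>. \<Sum>x\<in>T. c x * f x \<omega>)
          = gaussian (\<Sum>x\<in>T. c x * m x) (\<Sum>x\<in>T. \<Sum>x'\<in>T. c x * c x' * k x x'))"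

definition kernel_matrix :: "('a \<Rightarrow> 'a \<Rightarrow> real) \<Rightarrow> ('n \<Rightarrow> 'a) \<Rightarrow> real ^ 'n ^ 'n" where
  "kernel_matrix k xs = (\<chi> i j. k (xs i) (xs j))"

definition kernel_vector :: "('a \<Rightarrow> 'a \<Rightarrow> real) \<Rightarrow> ('n \<Rightarrow> 'a) \<Rightarrow> 'a \<Rightarrow> real ^ 'n" where
  "kernel_vector k xs x = (\<chi> i. k x (xs i))"

definition noisy_kernel_matrix ::
  "('a \<Rightarrow> 'a \<Rightarrow> real) \<Rightarrow> real \<Rightarrow> ('n \<Rightarrow> 'a) \<Rightarrow> real ^ 'n ^ 'n" where
  "noisy_kernel_matrix k \<sigma>n xs = kernel_matrix k xs + \<sigma>n\<^sup>2 *\<^sub>R mat 1"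

definition posterior_mean ::
  "('a \<Rightarrow> 'a \<Rightarrow> real) \<Rightarrow> real \<Rightarrow> ('n::finite \<Rightarrow> 'a) \<Rightarrow> real ^ 'n \<Rightarrow> 'a \<Rightarrow> real" where
  "posterior_mean k \<sigma>n xs y x =
     kernel_vector k xs x \<bullet> (matrix_inv (noisy_kernel_matrix k \<sigma>n xs) *v y)"

definition posterior_variance ::
  "('a \<Rightarrow> 'a \<Rightarrow> real) \<Rightarrow> real \<Rightarrow> ('n::finite \<Rightarrow> 'a) \<Rightarrow> 'a \<Rightarrow> real" where
  "posterior_variance k \<sigma>n xs x =
     k x x - kernel_vector k xs x
               \<bullet> (matrix_inv (noisy_kernel_matrix k \<sigma>n xs) *v kernel_vector k xs x)"

definition posterior_sd ::
  "('a \<Rightarrow> 'a \<Rightarrow> real) \<Rightarrow> real \<Rightarrow> ('n::finite \<Rightarrow> 'a) \<Rightarrow> 'a \<Rightarrow> real" where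
  "posterior_sd k \<sigma>n xs x = sqrt (posterior_variance k \<sigma>n xs x)"

(* w is also evaluated at 0 (coinciding points), and may take the value 0: a constant kernel has
   Lipschitz constant 0 and a constant posterior standard deviation. *)
definition admits_modulus ::
  "'a::metric_space set \<Rightarrow> (real \<Rightarrow> real) \<Rightarrow> ('a \<Rightarrow> real) \<Rightarrow> bool" where
  "admits_modulus S w g \<longleftrightarrow>
     (\<forall>t\<ge>0. 0 \<le> w t) \<and> (\<forall>x\<in>S. \<forall>x'\<in>S. \<bar>g x - g x'\<bar> \<le> w (dist x x'))"

definition covering_number :: "real \<Rightarrow> 'a::metric_space set \<Rightarrow> nat" where
  "covering_number \<tau> S =
     (LEAST n. \<exists>T. finite T \<and> T \<subseteq> S \<and> card T = n \<and> S \<subseteq> (\<Union>z\<in>T. cball z \<tau>))"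

end

theory Submission
  imports Defs
begin

text \<open>The posterior mean is linear, and the posterior variance a quadratic form, in the kernel vector
  \<open>k(x, X\<^sub>N)\<close>, whose Lipschitz constant is \<open>sqrt N * L\<^sub>k\<close>; with
  \<open>\<bar>sqrt a - sqrt b\<bar> \<le> sqrt \<bar>a - b\<bar>\<close> this gives the two regularity claims.

  For the error bound no conditioning on the data is needed: at a fixed \<open>x\<close> the error
  \<open>f(x) - \<nu>\<^sub>N(x)\<close> is a linear combination of values of \<open>f\<close> and of the noise, hence a centred
  Gaussian, and its variance is exactly \<open>\<sigma>\<^sub>N\<^sup>2(x)\<close>. The tail bound
  \<open>P(\<bar>Z\<bar> > r) \<le> exp (- r\<^sup>2 / 2)\<close> and a union bound over the centres of a minimal \<open>\<tau>\<close>-cover handle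
  all centres simultaneously, and the moduli of continuity transfer the bound from the nearest
  centre to an arbitrary point, at the price of \<open>\<gamma>(\<tau>)\<close>.\<close>

subsection \<open>Centred Gaussian laws\<close>

text \<open>For positive \<open>v\<close> this is the affine transformation of a normal density; for
  \<open>v = 0\<close> a constant map has a point mass as its image law. Merging the two branches
  here means that later proofs never unfold \<open>gaussian\<close>.\<close>

lemma gaussian_eq_distr:
  assumes "0 \<le> v"
  shows "gaussian m v = distr std_normal_distribution borel (\<lambda>z. m + sqrt v * z)"
proof (cases "v = 0")
  case True
  interpret N: prob_space std_normal_distribution
    by (simp add: prob_space_normal_density)
  show ?thesis
    using True N.distr_const[of m borel] by (simp add: gaussian_def)
next
  case False
  interpret N: prob_space std_normal_distribution
    by (simp add: prob_space_normal_density)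
  have "distributed std_normal_distribution lborel (\<lambda>z. z) std_normal_density"
    by (simp add: distributed_def distr_id2)
  from N.normal_density_affine[OF this, of "sqrt v" m]
  have "distributed std_normal_distribution lborel (\<lambda>z. m + sqrt v * z) (normal_density m (sqrt v))"
    using False assms by simp
  then have "distr std_normal_distribution lborel (\<lambda>z. m + sqrt v * z)
      = density lborel (normal_density m (sqrt v))"
    by (rule distributed_distr_eq_density)
  moreover have "distr std_normal_distribution lborel (\<lambda>z. m + sqrt v * z)
      = distr std_normal_distribution borel (\<lambda>z. m + sqrt v * z)"
    by (rule distr_cong) auto
  ultimately show ?thesis
    using False assms by (simp add: gaussian_def)
qed

lemma real_distribution_gaussian:
  assumes "0 \<le> v"
  shows "real_distribution (gaussian m v)"
proof -
  interpret N: prob_space std_normal_distribution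
    by (simp add: prob_space_normal_density)
  show ?thesis
    unfolding gaussian_eq_distr[OF assms] by (rule N.real_distribution_distr) simp
qed

lemma char_gaussian_centered:
  assumes "0 \<le> v"
  shows "char (gaussian 0 v) t = complex_of_real (exp (- (v * t\<^sup>2) / 2))"
proof -
  have "char (gaussian 0 v) t = char std_normal_distribution (t * sqrt v)"
    unfolding char_def gaussian_eq_distr[OF assms]
    by (subst integral_distr) (auto simp: mult.assoc)
  also have "\<dots> = complex_of_real (exp (- (v * t\<^sup>2) / 2))"
    using assms by (simp add: char_std_normal_distribution power_mult_distrib mult.commute)
  finally show ?thesis .
qed

lemma std_normal_tail:
  assumes "0 \<le> r"
  shows "measure std_normal_distribution {z. r < \<bar>z\<bar>} \<le> exp (- r\<^sup>2 / 2)"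
proof -
  interpret N: prob_space std_normal_distribution
    by (simp add: prob_space_normal_density)
  \<comment> \<open>Substituting \<open>z = \<plusminus>r + u\<close> in the two tails costs a factor \<open>exp (- r\<^sup>2 / 2)\<close> each, and the
    shifted half-lines together make up a single copy of the line, so no factor 2 is lost.\<close>
  have shifted: "std_normal_density (s * r + u) \<le> exp (- r\<^sup>2 / 2) * std_normal_density u"
    if "0 \<le> s * u" "s\<^sup>2 = 1" for s u :: real
  proof -
    \<comment> \<open>The sign condition makes the cross term of the square nonnegative; dropping it
      gives the inequality.\<close>
    have "0 \<le> r * (s * u)"
      using that(1) assms by (rule mult_nonneg_nonneg[rotated])
    moreover have "(s * r + u)\<^sup>2 = r\<^sup>2 + u\<^sup>2 + 2 * (r * (s * u))"
      using that(2) by (simp add: power2_sum power_mult_distrib)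
    ultimately have "- (s * r + u)\<^sup>2 / 2 \<le> - r\<^sup>2 / 2 + - u\<^sup>2 / 2"
      by simp
    then have "exp (- (s * r + u)\<^sup>2 / 2) \<le> exp (- r\<^sup>2 / 2) * exp (- u\<^sup>2 / 2)"
      by (metis exp_add exp_le_cancel_iff)
    then show ?thesis
      unfolding std_normal_density_def by (simp add: divide_simps)
  qed
  define \<phi> where "\<phi> = (\<lambda>z. ennreal (std_normal_density z))"
  have [measurable]: "\<phi> \<in> borel_measurable borel"
    by (simp add: \<phi>_def)
  have \<phi>_shift: "\<phi> (s * r + u) \<le> ennreal (exp (- r\<^sup>2 / 2)) * \<phi> u"
    if "0 \<le> s * u" "s\<^sup>2 = 1" for s u :: real
    using shifted[OF that] by (simp add: \<phi>_def flip: ennreal_mult')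
  have "emeasure std_normal_distribution {z. r < \<bar>z\<bar>}
      = (\<integral>\<^sup>+ z. \<phi> z * indicator {r<..} z + \<phi> z * indicator {..<-r} z \<partial>lborel)"
    using assms
    by (subst emeasure_density) (auto simp: \<phi>_def intro!: nn_integral_cong split: split_indicator)
  also have "\<dots> = (\<integral>\<^sup>+ z. \<phi> z * indicator {r<..} z \<partial>lborel)
      + (\<integral>\<^sup>+ z. \<phi> z * indicator {..<-r} z \<partial>lborel)"
    by (rule nn_integral_add) auto
  also have "(\<integral>\<^sup>+ z. \<phi> z * indicator {r<..} z \<partial>lborel)
      = (\<integral>\<^sup>+ u. \<phi> (r + u) * indicator {0<..} u \<partial>lborel)"
    by (subst nn_integral_real_affine[where c = 1 and t = r])
       (auto intro!: nn_integral_cong split: split_indicator)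
  also have "\<dots> \<le> (\<integral>\<^sup>+ u. ennreal (exp (- r\<^sup>2 / 2)) * (\<phi> u * indicator {0<..} u) \<partial>lborel)"
    using \<phi>_shift[of 1] by (intro nn_integral_mono) (auto split: split_indicator)
  also have "(\<integral>\<^sup>+ z. \<phi> z * indicator {..<-r} z \<partial>lborel)
      = (\<integral>\<^sup>+ u. \<phi> (- r + u) * indicator {..<0} u \<partial>lborel)"
    by (subst nn_integral_real_affine[where c = 1 and t = "- r"])
       (auto intro!: nn_integral_cong split: split_indicator)
  also have "\<dots> \<le> (\<integral>\<^sup>+ u. ennreal (exp (- r\<^sup>2 / 2)) * (\<phi> u * indicator {..<0} u) \<partial>lborel)"
    using \<phi>_shift[of "-1"] by (intro nn_integral_mono) (auto split: split_indicator)
  also have "(\<integral>\<^sup>+ u. ennreal (exp (- r\<^sup>2 / 2)) * (\<phi> u * indicator {0<..} u) \<partial>lborel)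
      + (\<integral>\<^sup>+ u. ennreal (exp (- r\<^sup>2 / 2)) * (\<phi> u * indicator {..<0} u) \<partial>lborel)
      = (\<integral>\<^sup>+ u. ennreal (exp (- r\<^sup>2 / 2)) * (\<phi> u * indicator {0<..} u + \<phi> u * indicator {..<0} u) \<partial>lborel)"
    by (subst nn_integral_add[symmetric]) (auto simp: distrib_left)
  \<comment> \<open>The two open half-lines are disjoint, so their indicators add up to at most
    1.\<close>
  also have "\<dots> \<le> (\<integral>\<^sup>+ u. ennreal (exp (- r\<^sup>2 / 2)) * \<phi> u \<partial>lborel)"
    by (intro nn_integral_mono) (auto split: split_indicator)
  also have "\<dots> = ennreal (exp (- r\<^sup>2 / 2)) * emeasure std_normal_distribution UNIV"
    by (subst nn_integral_cmult) (auto simp: emeasure_density \<phi>_def)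
  also have "emeasure std_normal_distribution UNIV = 1"
    using N.emeasure_space_1 by simp
  finally show ?thesis
    by (simp add: N.emeasure_eq_measure add_mono)
qed

text \<open>Scaling reduces this to the standard normal law. The factor in front of the exponential
  stays 1, which the choice of \<open>\<beta>\<close> relies on; the event is strict, so it is null
  for \<open>v = 0\<close>.\<close>

lemma gaussian_centered_tail:
  assumes "0 \<le> v" "0 \<le> r"
  shows "measure (gaussian 0 v) {t. r * sqrt v < \<bar>t\<bar>} \<le> exp (- r\<^sup>2 / 2)"
proof -
  interpret N: prob_space std_normal_distribution
    by (simp add: prob_space_normal_density)
  have "measure (gaussian 0 v) {t. r * sqrt v < \<bar>t\<bar>}
      = measure std_normal_distribution {z. r * sqrt v < \<bar>sqrt v * z\<bar>}"
    unfolding gaussian_eq_distr[OF assms(1)] by (subst measure_distr) (auto simp: vimage_def)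
  also have "\<dots> \<le> measure std_normal_distribution {z. r < \<bar>z\<bar>}"
  proof (rule N.finite_measure_mono)
    show "{z. r * sqrt v < \<bar>sqrt v * z\<bar>} \<subseteq> {z. r < \<bar>z\<bar>}"
      using assms(1) by (auto simp: abs_mult mult.commute mult_less_cancel_right)
  qed auto
  also have "\<dots> \<le> exp (- r\<^sup>2 / 2)"
    by (rule std_normal_tail[OF assms(2)])
  finally show ?thesis .
qed

text \<open>Scaling by \<open>c\<close> turns \<open>char\<close> at \<open>t\<close> into
  \<open>char\<close> at \<open>t * c\<close>. Posterior weights may vanish; for
  \<open>c = 0\<close> both sides are the point mass at 0.\<close>

lemma gaussian_scale:
  assumes "0 \<le> v"
  shows "distr (gaussian 0 v) borel ((*) c) = gaussian 0 (c\<^sup>2 * v)"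
proof (rule Levy_uniqueness)
  interpret G: real_distribution "gaussian 0 v"
    by (rule real_distribution_gaussian[OF assms])
  show "real_distribution (distr (gaussian 0 v) borel ((*) c))"
    by (rule G.real_distribution_distr) simp
  show "real_distribution (gaussian 0 (c\<^sup>2 * v))"
    using assms by (intro real_distribution_gaussian) simp
  show "char (distr (gaussian 0 v) borel ((*) c)) = char (gaussian 0 (c\<^sup>2 * v))"
  proof
    fix t
    have "char (distr (gaussian 0 v) borel ((*) c)) t = char (gaussian 0 v) (t * c)"
      unfolding char_def by (subst integral_distr) (auto simp: mult.assoc)
    then show "char (distr (gaussian 0 v) borel ((*) c)) t = char (gaussian 0 (c\<^sup>2 * v)) t"
      using assms by (simp add: char_gaussian_centered power_mult_distrib mult_ac)
  qed
qed

context prob_space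
begin

text \<open>Characteristic functions of independent variables multiply, so the exponents, and with
  them the variances, add; summands of variance 0 are included.\<close>

lemma distr_sum_indep_gaussian:
  fixes X :: "'i \<Rightarrow> 'a \<Rightarrow> real"
  assumes "indep_vars (\<lambda>_. borel) X I"
    and gauss: "\<And>i. i \<in> I \<Longrightarrow> distr M borel (X i) = gaussian 0 (v i)"
    and "\<And>i. i \<in> I \<Longrightarrow> 0 \<le> v i"
  shows "distr M borel (\<lambda>\<omega>. \<Sum>i\<in>I. X i \<omega>) = gaussian 0 (\<Sum>i\<in>I. v i)"
proof (rule Levy_uniqueness)
  have [measurable]: "X i \<in> borel_measurable M" if "i \<in> I" for i
    using assms(1) that by (auto simp: indep_vars_def)
  have nonneg: "0 \<le> (\<Sum>i\<in>I. v i)"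
    using assms(3) by (rule sum_nonneg)
  show "real_distribution (distr M borel (\<lambda>\<omega>. \<Sum>i\<in>I. X i \<omega>))"
    by (rule real_distribution_distr) measurable
  show "real_distribution (gaussian 0 (\<Sum>i\<in>I. v i))"
    by (rule real_distribution_gaussian[OF nonneg])
  show "char (distr M borel (\<lambda>\<omega>. \<Sum>i\<in>I. X i \<omega>)) = char (gaussian 0 (\<Sum>i\<in>I. v i))"
  proof
    fix t
    have "char (distr M borel (\<lambda>\<omega>. \<Sum>i\<in>I. X i \<omega>)) t
        = (\<Prod>i\<in>I. char (distr M borel (X i)) t)"
      by (rule char_distr_sum[OF assms(1)])
    also have "\<dots> = (\<Prod>i\<in>I. complex_of_real (exp (- (v i * t\<^sup>2) / 2)))"
      by (intro prod.cong) (simp_all add: gauss char_gaussian_centered assms(3))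
    also have "\<dots> = complex_of_real (\<Prod>i\<in>I. exp (- (v i * t\<^sup>2) / 2))"
      by simp
    \<comment> \<open>For infinite \<open>I\<close> the product defaults to 1 and the sum to 0, so
      the two sides still agree.\<close>
    also have "(\<Prod>i\<in>I. exp (- (v i * t\<^sup>2) / 2)) = exp (- ((\<Sum>i\<in>I. v i) * t\<^sup>2) / 2)"
      by (cases "finite I")
         (simp_all add: exp_sum[symmetric] sum_negf sum_divide_distrib sum_distrib_right)
    finally show "char (distr M borel (\<lambda>\<omega>. \<Sum>i\<in>I. X i \<omega>)) t = char (gaussian 0 (\<Sum>i\<in>I. v i)) t"
      by (simp add: char_gaussian_centered[OF nonneg])
  qed
qed

lemma distr_add_indep_gaussian:
  assumes "indep_var borel X borel Y"
    and "distr M borel X = gaussian 0 v" "distr M borel Y = gaussian 0 w"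
    and "0 \<le> v" "0 \<le> w"
  shows "distr M borel (\<lambda>\<omega>. X \<omega> + Y \<omega>) = gaussian 0 (v + w)"
proof (rule Levy_uniqueness)
  have [measurable]: "X \<in> borel_measurable M" "Y \<in> borel_measurable M"
    using assms(1) by (auto simp: indep_var_eq)
  show "real_distribution (distr M borel (\<lambda>\<omega>. X \<omega> + Y \<omega>))"
    by (rule real_distribution_distr) measurable
  show "real_distribution (gaussian 0 (v + w))"
    using assms(4,5) by (intro real_distribution_gaussian) simp
  show "char (distr M borel (\<lambda>\<omega>. X \<omega> + Y \<omega>)) = char (gaussian 0 (v + w))"
    using assms(4,5)
    by (auto simp: char_distr_add[OF assms(1)] assms(2,3) char_gaussian_centered
        add_divide_distrib distrib_right exp_add[symmetric] simp flip: of_real_mult)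
qed

end

subsection \<open>Quadratic forms of a kernel over families of points\<close>

text \<open>Both \<open>covariance_kernel\<close> and \<open>gaussian_process\<close> speak of
  finite sets of points, while the inputs form a family that may repeat points. Adding the
  coefficients of coinciding points passes from one to the other.\<close>

lemma sum_regroup:
  fixes b :: "'i \<Rightarrow> real"
  assumes "finite I"
  shows "(\<Sum>z\<in>u ` I. (\<Sum>i\<in>{i\<in>I. u i = z}. b i) * g z) = (\<Sum>i\<in>I. b i * g (u i))"
proof -
  have "(\<Sum>i\<in>I. b i * g (u i)) = (\<Sum>z\<in>u ` I. \<Sum>i\<in>{i\<in>I. u i = z}. b i * g (u i))"
    by (rule sum.image_gen[OF assms])
  also have "\<dots> = (\<Sum>z\<in>u ` I. (\<Sum>i\<in>{i\<in>I. u i = z}. b i) * g z)"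
    by (intro sum.cong) (auto simp: sum_distrib_right)
  finally show ?thesis ..
qed

lemma double_sum_regroup:
  fixes b :: "'i \<Rightarrow> real"
  assumes "finite I"
  shows "(\<Sum>z\<in>u ` I. \<Sum>z'\<in>u ` I. (\<Sum>i\<in>{i\<in>I. u i = z}. b i) * (\<Sum>i\<in>{i\<in>I. u i = z'}. b i) * k z z')
    = (\<Sum>i\<in>I. \<Sum>j\<in>I. b i * b j * k (u i) (u j))"
proof -
  \<comment> \<open>Pulling the outer coefficient out of the inner sum leaves two nested single
    sums, to each of which \<open>sum_regroup\<close> applies.\<close>
  have factor: "(\<Sum>z\<in>S. \<Sum>z'\<in>S. B z * B z' * h z z') = (\<Sum>z\<in>S. B z * (\<Sum>z'\<in>S. B z' * h z z'))"
    for S :: "'j set" and B :: "'j \<Rightarrow> real" and h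
    by (simp add: sum_distrib_left mult.assoc)
  show ?thesis
    unfolding factor sum_regroup[OF assms] ..
qed

lemma covariance_kernel_family_nonneg:
  assumes "covariance_kernel k" "finite I"
  shows "0 \<le> (\<Sum>i\<in>I. \<Sum>j\<in>I. b i * b j * k (u i) (u j))"
  using assms(1)[unfolded covariance_kernel_def, THEN conjunct2, THEN conjunct2, rule_format,
      of "u ` I" "\<lambda>z. \<Sum>i\<in>{i\<in>I. u i = z}. b i"] assms(2)
  by (simp add: double_sum_regroup)

lemma gaussian_process_family:
  assumes "gaussian_process M S (\<lambda>_. 0) k f" "finite I" "u ` I \<subseteq> S"
  shows "distr M borel (\<lambda>\<omega>. \<Sum>i\<in>I. b i * f (u i) \<omega>)
    = gaussian 0 (\<Sum>i\<in>I. \<Sum>j\<in>I. b i * b j * k (u i) (u j))"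
  using assms(1)[unfolded gaussian_process_def, THEN conjunct2, rule_format,
      of "u ` I" "\<lambda>z. \<Sum>i\<in>{i\<in>I. u i = z}. b i"] assms(2,3)
  by (simp add: double_sum_regroup sum_regroup[where g = "\<lambda>z. f z _"])

subsection \<open>The law of the prediction error\<close>

lemma sum_UNIV_option:
  fixes g :: "'n::finite option \<Rightarrow> real"
  shows "(\<Sum>p\<in>UNIV. g p) = g None + (\<Sum>i\<in>UNIV. g (Some i))"
  by (simp add: UNIV_option_conv sum.reindex)

text \<open>With \<open>v*\<close> in place of \<open>*v\<close>, the symmetry of the inverse matrix is never needed.\<close>

definition posterior_weights ::
  "('a \<Rightarrow> 'a \<Rightarrow> real) \<Rightarrow> real \<Rightarrow> ('n::finite \<Rightarrow> 'a) \<Rightarrow> 'a \<Rightarrow> real ^ 'n" where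
  "posterior_weights k \<sigma>n xs x = kernel_vector k xs x v* matrix_inv (noisy_kernel_matrix k \<sigma>n xs)"

text \<open>Coefficients of the noise-free part of the prediction error at \<open>x\<close>, indexed by the family
  \<open>case_option x xs\<close>, which may contain repeated points.\<close>

definition error_coeff :: "real ^ 'n \<Rightarrow> 'n option \<Rightarrow> real" where
  "error_coeff a = case_option 1 (\<lambda>i. - a $ i)"

lemma error_coeff_simps [simp]: "error_coeff a None = 1" "error_coeff a (Some i) = - a $ i"
  by (simp_all add: error_coeff_def)

lemma posterior_mean_eq_weights:
  "posterior_mean k \<sigma>n xs y x = posterior_weights k \<sigma>n xs x \<bullet> y"
  by (simp add: posterior_mean_def posterior_weights_def dot_lmul_matrix)

text \<open>With \<open>B\<close> the noisy kernel matrix, \<open>v\<close> the kernel vector and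
  \<open>c\<close> the weights, \<open>c v* B = v\<close> gives
  \<open>c \<bullet> (B *v c) = v \<bullet> c\<close>. So \<open>k x x - v \<bullet> c\<close>
  equals \<open>k x x - 2 * (v \<bullet> c) + c \<bullet> (B *v c)\<close>, the variance of
  \<open>f x\<close> minus the weighted observations; splitting \<open>B\<close> separates the share
  of \<open>f\<close> from that of the noise.\<close>

lemma posterior_variance_eq:
  fixes xs :: "'n::finite \<Rightarrow> 'a"
  assumes "\<And>x x'. k x x' = k x' x" and inv: "invertible (noisy_kernel_matrix k \<sigma>n xs)"
  defines "a \<equiv> \<lambda>x. posterior_weights k \<sigma>n xs x"
  shows "posterior_variance k \<sigma>n xs x =
    (\<Sum>p\<in>UNIV. \<Sum>q\<in>UNIV. error_coeff (a x) p * error_coeff (a x) q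
        * k (case_option x xs p) (case_option x xs q))
    + (\<Sum>i\<in>UNIV. (a x $ i)\<^sup>2 * \<sigma>n\<^sup>2)"
proof -
  define B where "B = noisy_kernel_matrix k \<sigma>n xs"
  define v where "v = kernel_vector k xs x"
  define c where "c = a x"
  have c: "c = v v* matrix_inv B"
    by (simp add: c_def a_def v_def B_def posterior_weights_def)
  have "matrix_inv B ** B = mat 1"
    using inv unfolding B_def matrix_inv_def invertible_def by (rule someI2_ex) blast
  then have "c v* B = v"
    by (simp add: c vector_matrix_mul_assoc)
  then have cBc: "c \<bullet> (B *v c) = v \<bullet> c"
    by (metis dot_lmul_matrix)
  have "B *v c = kernel_matrix k xs *v c + \<sigma>n\<^sup>2 *\<^sub>R c"
    by (simp add: B_def noisy_kernel_matrix_def matrix_vector_mult_add_rdistrib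
        scaleR_matrix_vector_assoc[symmetric])
  then have "c \<bullet> (B *v c)
      = (\<Sum>i\<in>UNIV. \<Sum>j\<in>UNIV. c $ i * c $ j * k (xs i) (xs j)) + (\<Sum>i\<in>UNIV. (c $ i)\<^sup>2 * \<sigma>n\<^sup>2)"
    by (simp add: inner_add_right inner_vec_def matrix_vector_mult_def kernel_matrix_def
        sum_distrib_left sum.distrib distrib_left power2_eq_square mult_ac)
  moreover have "v \<bullet> c = (\<Sum>i\<in>UNIV. c $ i * k x (xs i))"
    by (simp add: v_def kernel_vector_def inner_vec_def mult.commute)
  moreover have "posterior_variance k \<sigma>n xs x = k x x - v \<bullet> c"
    unfolding posterior_variance_def c inner_commute[of v] dot_lmul_matrix
    by (simp add: v_def B_def inner_commute)
  \<comment> \<open>Symmetry merges the mixed terms with indices \<open>None, Some i\<close> and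
    \<open>Some i, None\<close> into the factor 2.\<close>
  moreover have "k (xs i) x = k x (xs i)" for i
    by (rule assms(1))
  then have "(\<Sum>p\<in>UNIV. \<Sum>q\<in>UNIV. error_coeff c p * error_coeff c q
      * k (case_option x xs p) (case_option x xs q))
      = k x x - 2 * (\<Sum>i\<in>UNIV. c $ i * k x (xs i))
        + (\<Sum>i\<in>UNIV. \<Sum>j\<in>UNIV. c $ i * c $ j * k (xs i) (xs j))"
    by (simp add: sum_UNIV_option sum.distrib sum_subtractf sum_negf)
  ultimately show ?thesis
    using cBc by (simp flip: c_def)
qed

text \<open>The definition is a difference, but the decomposition above is a kernel form plus
  squares. This makes \<open>posterior_sd\<close> a genuine square root and allows the value to act
  as a variance.\<close>

lemma posterior_variance_nonneg:
  fixes xs :: "'n::finite \<Rightarrow> 'a"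
  assumes "covariance_kernel k" "invertible (noisy_kernel_matrix k \<sigma>n xs)"
  shows "0 \<le> posterior_variance k \<sigma>n xs x"
proof -
  have sym: "k z z' = k z' z" for z z'
    using assms(1) by (simp add: covariance_kernel_def)
  show ?thesis
    by (subst posterior_variance_eq[OF sym assms(2)])
       (intro add_nonneg_nonneg sum_nonneg covariance_kernel_family_nonneg[OF assms(1)]; simp)
qed

text \<open>Independence is given for the sigma-algebras generated by the whole process on
  \<open>X\<close> and by the noise vector. Each sum is measurable for one of them, hence generates
  a sub-sigma-algebra and inherits independence.\<close>

lemma (in prob_space) indep_sums_of_indep_set:
  fixes f :: "'b \<Rightarrow> 'a \<Rightarrow> real" and \<epsilon> :: "'n::finite \<Rightarrow> 'a \<Rightarrow> real"
  assumes f: "\<And>x. x \<in> X \<Longrightarrow> f x \<in> borel_measurable M"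
    and \<epsilon>: "\<And>i. \<epsilon> i \<in> borel_measurable M"
    and indep: "indep_set
        (sets (vimage_algebra (space M) (\<lambda>\<omega>. \<lambda>x\<in>X. f x \<omega>) (\<Pi>\<^sub>M x\<in>X. borel)))
        (sets (vimage_algebra (space M) (\<lambda>\<omega> i. \<epsilon> i \<omega>) (\<Pi>\<^sub>M i\<in>UNIV. borel)))"
    and u: "\<And>p. p \<in> I \<Longrightarrow> u p \<in> X"
  shows "indep_var borel (\<lambda>\<omega>. \<Sum>p\<in>I. b p * f (u p) \<omega>) borel (\<lambda>\<omega>. \<Sum>i\<in>UNIV. c i * \<epsilon> i \<omega>)"
proof -
  let ?F = "\<lambda>\<omega>. \<Sum>p\<in>I. b p * f (u p) \<omega>" and ?G = "\<lambda>\<omega>. \<Sum>i\<in>UNIV. c i * \<epsilon> i \<omega>"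
  let ?U = "vimage_algebra (space M) (\<lambda>\<omega>. \<lambda>x\<in>X. f x \<omega>) (\<Pi>\<^sub>M x\<in>X. borel :: real measure)"
  let ?V = "vimage_algebra (space M) (\<lambda>\<omega> i. \<epsilon> i \<omega>) (\<Pi>\<^sub>M i\<in>UNIV. borel :: real measure)"
  have F: "?F \<in> borel_measurable ?U"
  proof (intro borel_measurable_sum borel_measurable_times borel_measurable_const)
    fix p assume "p \<in> I"
    \<comment> \<open>Evaluation at \<open>u p\<close> recovers \<open>f (u p)\<close> from the
      restricted function because \<open>u p\<close> lies in \<open>X\<close>.\<close>
    have "(\<lambda>\<omega>. \<lambda>x\<in>X. f x \<omega>) \<in> measurable ?U (\<Pi>\<^sub>M x\<in>X. borel)"
      by (rule measurable_vimage_algebra1) (simp add: space_PiM)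
    from measurable_compose[OF this measurable_component_singleton[OF u[OF \<open>p \<in> I\<close>]]]
    show "f (u p) \<in> borel_measurable ?U"
      using u[OF \<open>p \<in> I\<close>] by simp
  qed
  have G: "?G \<in> borel_measurable ?V"
  proof (intro borel_measurable_sum borel_measurable_times borel_measurable_const)
    fix i
    have "(\<lambda>\<omega> i. \<epsilon> i \<omega>) \<in> measurable ?V (\<Pi>\<^sub>M i\<in>UNIV. borel)"
      by (rule measurable_vimage_algebra1) (simp add: space_PiM)
    from measurable_compose[OF this measurable_component_singleton[OF UNIV_I]]
    show "\<epsilon> i \<in> borel_measurable ?V"
      by simp
  qed
  have generated: "sigma_sets (space M) {H -` A \<inter> space M |A. A \<in> sets borel} \<subseteq> sets W"
    if "H \<in> borel_measurable W" "space W = space M" for H :: "'a \<Rightarrow> real" and W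
  proof -
    have "{H -` A \<inter> space M |A. A \<in> sets borel} \<subseteq> sets W"
      using measurable_sets[OF that(1)] that(2) by auto
    from sets.sigma_sets_subset[OF this] show ?thesis
      by (simp add: that(2))
  qed
  have "indep_set (sigma_sets (space M) {?F -` A \<inter> space M |A. A \<in> sets borel})
      (sigma_sets (space M) {?G -` A \<inter> space M |A. A \<in> sets borel})"
    unfolding indep_set_def
    by (rule indep_sets_mono_sets[OF indep[unfolded indep_set_def]])
       (use generated[OF F] generated[OF G] in \<open>auto split: bool.split\<close>)
  moreover have "?F \<in> borel_measurable M" "?G \<in> borel_measurable M"
    using f \<epsilon> u by (auto intro!: borel_measurable_sum borel_measurable_times)
  ultimately show ?thesis
    by (simp add: indep_var_eq)
qed

text \<open>In the error, \<open>F\<close> collects the values of \<open>f\<close> and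
  \<open>G\<close> the noise. Both are centred Gaussians, they are independent, and their variances
  are the two summands in \<open>posterior_variance_eq\<close>.\<close>

lemma (in prob_space) posterior_error_distr:
  fixes xs :: "'n::finite \<Rightarrow> 'b" and y :: "'a \<Rightarrow> real ^ 'n"
  assumes kernel: "covariance_kernel k"
    and gp: "gaussian_process M X (\<lambda>_. 0) k f"
    and \<epsilon>: "\<And>i. \<epsilon> i \<in> borel_measurable M" "\<And>i. distr M borel (\<epsilon> i) = gaussian 0 (\<sigma>n\<^sup>2)"
    and \<epsilon>_indep: "indep_vars (\<lambda>_. borel) \<epsilon> UNIV"
    and indep: "indep_set
        (sets (vimage_algebra (space M) (\<lambda>\<omega>. \<lambda>x\<in>X. f x \<omega>) (\<Pi>\<^sub>M x\<in>X. borel)))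
        (sets (vimage_algebra (space M) (\<lambda>\<omega> i. \<epsilon> i \<omega>) (\<Pi>\<^sub>M i\<in>UNIV. borel)))"
    and y: "\<And>\<omega> i. \<omega> \<in> space M \<Longrightarrow> y \<omega> $ i = f (xs i) \<omega> + \<epsilon> i \<omega>"
    and inv: "invertible (noisy_kernel_matrix k \<sigma>n xs)"
    and xs: "\<And>i. xs i \<in> X" and x: "x \<in> X"
  shows "distr M borel (\<lambda>\<omega>. f x \<omega> - posterior_mean k \<sigma>n xs (y \<omega>) x)
    = gaussian 0 (posterior_variance k \<sigma>n xs x)"
proof -
  define a where "a = posterior_weights k \<sigma>n xs x"
  define u where "u = case_option x xs"
  have uX: "u p \<in> X" for p
    using xs x by (simp add: u_def split: option.split)
  have f: "z \<in> X \<Longrightarrow> f z \<in> borel_measurable M" for z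
    using gp by (simp add: gaussian_process_def)
  define F where "F = (\<lambda>\<omega>. \<Sum>p\<in>UNIV. error_coeff a p * f (u p) \<omega>)"
  define G where "G = (\<lambda>\<omega>. \<Sum>i\<in>UNIV. (- a $ i) * \<epsilon> i \<omega>)"
  define vF where "vF = (\<Sum>p\<in>UNIV. \<Sum>q\<in>UNIV. error_coeff a p * error_coeff a q * k (u p) (u q))"
  define vG where "vG = (\<Sum>i\<in>UNIV. (- a $ i)\<^sup>2 * \<sigma>n\<^sup>2)"
  have "distr M borel F = gaussian 0 vF"
    unfolding F_def vF_def using uX by (intro gaussian_process_family[OF gp]) auto
  moreover have "distr M borel G = gaussian 0 vG"
    unfolding G_def vG_def
  proof (rule distr_sum_indep_gaussian)
    show "indep_vars (\<lambda>_. borel) (\<lambda>i \<omega>. (- a $ i) * \<epsilon> i \<omega>) UNIV"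
      by (rule indep_vars_compose2[OF \<epsilon>_indep]) simp
    show "distr M borel (\<lambda>\<omega>. (- a $ i) * \<epsilon> i \<omega>) = gaussian 0 ((- a $ i)\<^sup>2 * \<sigma>n\<^sup>2)" for i
      using gaussian_scale[of "\<sigma>n\<^sup>2" "- a $ i"] \<epsilon>(1)[of i]
      by (simp add: distr_distr comp_def flip: \<epsilon>(2)[of i])
  qed simp
  moreover have "indep_var borel F borel G"
    unfolding F_def G_def using f \<epsilon>(1) indep uX by (rule indep_sums_of_indep_set)
  moreover have "0 \<le> vF"
    unfolding vF_def by (rule covariance_kernel_family_nonneg[OF kernel]) simp
  moreover have "0 \<le> vG"
    unfolding vG_def by (intro sum_nonneg) simp
  ultimately have "distr M borel (\<lambda>\<omega>. F \<omega> + G \<omega>) = gaussian 0 (vF + vG)"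
    by (intro distr_add_indep_gaussian)
  moreover have "vF + vG = posterior_variance k \<sigma>n xs x"
    using kernel by (subst posterior_variance_eq[OF _ inv])
      (auto simp: vF_def vG_def a_def u_def covariance_kernel_def)
  \<comment> \<open>The data equation for \<open>y\<close> is available on \<open>space M\<close>
    only, which is enough to determine the law.\<close>
  moreover have "F \<omega> + G \<omega> = f x \<omega> - posterior_mean k \<sigma>n xs (y \<omega>) x" if "\<omega> \<in> space M" for \<omega>
    using y[OF that]
    by (simp add: F_def G_def u_def posterior_mean_eq_weights inner_vec_def sum_UNIV_option
        distrib_left sum.distrib sum_negf flip: a_def)
  then have "distr M borel (\<lambda>\<omega>. F \<omega> + G \<omega>)
      = distr M borel (\<lambda>\<omega>. f x \<omega> - posterior_mean k \<sigma>n xs (y \<omega>) x)"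
    by (intro distr_cong) auto
  ultimately show ?thesis
    by simp
qed

subsection \<open>Regularity of the posterior\<close>

text \<open>Changing one argument of the bilinear form at a time gives two terms, each bounded by
  Cauchy-Schwarz and the operator norm.\<close>

lemma inner_matrix_bilinear_diff:
  fixes A :: "real ^ 'n ^ 'n"
  shows "\<bar>u \<bullet> (A *v u) - v \<bullet> (A *v v)\<bar> \<le> norm (u - v) * onorm ((*v) A) * (norm u + norm v)"
proof -
  have "u \<bullet> (A *v u) - v \<bullet> (A *v v) = (u - v) \<bullet> (A *v u) + v \<bullet> (A *v (u - v))"
    by (simp add: inner_diff_left inner_diff_right matrix_vector_mult_diff_distrib)
  also have "\<bar>\<dots>\<bar> \<le> norm (u - v) * norm (A *v u) + norm v * norm (A *v (u - v))"
    by (meson Cauchy_Schwarz_ineq2 abs_triangle_ineq add_mono order_trans)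
  also have "\<dots> \<le> norm (u - v) * (onorm ((*v) A) * norm u)
      + norm v * (onorm ((*v) A) * norm (u - v))"
    by (intro add_mono mult_left_mono onorm) auto
  finally show ?thesis
    by (simp add: algebra_simps)
qed

lemma norm_le_sqrt_card_mult:
  fixes v :: "real ^ 'n"
  assumes "\<And>i. \<bar>v $ i\<bar> \<le> c"
  shows "norm v \<le> sqrt (real CARD('n)) * c"
proof -
  \<comment> \<open>Index types are nonempty, so a single coordinate, here the one at
    \<open>undefined\<close>, forces \<open>c\<close> to be nonnegative.\<close>
  have "0 \<le> c"
    using assms[of undefined] by linarith
  have "(\<Sum>i\<in>UNIV. (v $ i)\<^sup>2) \<le> (\<Sum>i\<in>(UNIV :: 'n set). c\<^sup>2)"
    using assms by (intro sum_mono) (metis abs_ge_zero power2_abs power_mono)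
  then have "sqrt (\<Sum>i\<in>UNIV. (v $ i)\<^sup>2) \<le> sqrt (real CARD('n) * c\<^sup>2)"
    by simp
  then show ?thesis
    using \<open>0 \<le> c\<close> by (simp add: norm_vec_def L2_set_def real_sqrt_mult)
qed

text \<open>Multiply \<open>\<bar>sqrt a - sqrt b\<bar> \<le> sqrt a + sqrt b\<close> by its left
  side. Applied to variances, this is the source of the square root in the modulus of the standard
  deviation.\<close>

lemma abs_sqrt_diff_le:
  fixes a b :: real
  assumes "0 \<le> a" "0 \<le> b"
  shows "\<bar>sqrt a - sqrt b\<bar> \<le> sqrt \<bar>a - b\<bar>"
proof -
  have "\<bar>sqrt a - sqrt b\<bar>\<^sup>2 \<le> \<bar>sqrt a - sqrt b\<bar> * (sqrt a + sqrt b)"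
    unfolding power2_eq_square using assms by (intro mult_left_mono) (auto simp: abs_le_iff)
  also have "\<dots> = \<bar>(sqrt a - sqrt b) * (sqrt a + sqrt b)\<bar>"
    using assms by (simp add: abs_mult)
  also have "\<dots> = \<bar>a - b\<bar>"
    using assms by (simp add: algebra_simps)
  finally show ?thesis
    by (rule real_le_rsqrt)
qed

lemma norm_kernel_vector_diff_le:
  fixes xs :: "'n::finite \<Rightarrow> 'a::metric_space"
  assumes "\<forall>z\<in>X. L-lipschitz_on X (\<lambda>x. k x z)" "\<And>i. xs i \<in> X" "x \<in> X" "x' \<in> X"
  shows "norm (kernel_vector k xs x - kernel_vector k xs x') \<le> sqrt (real CARD('n)) * (L * dist x x')"
proof (rule norm_le_sqrt_card_mult)
  fix i
  have "dist (k x (xs i)) (k x' (xs i)) \<le> L * dist x x'"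
    using assms by (auto intro: lipschitz_onD)
  then show "\<bar>(kernel_vector k xs x - kernel_vector k xs x') $ i\<bar> \<le> L * dist x x'"
    by (simp add: kernel_vector_def dist_real_def)
qed

lemma posterior_mean_lipschitz_on:
  fixes xs :: "'n::finite \<Rightarrow> 'a::metric_space"
  assumes lip: "\<forall>z\<in>X. L-lipschitz_on X (\<lambda>x. k x z)" and xs: "\<And>i. xs i \<in> X"
  shows "(L * sqrt (real CARD('n)) * norm (matrix_inv (noisy_kernel_matrix k \<sigma>n xs) *v y))-lipschitz_on X
    (posterior_mean k \<sigma>n xs y)"
proof (rule lipschitz_onI)
  fix x x' assume "x \<in> X" "x' \<in> X"
  let ?w = "matrix_inv (noisy_kernel_matrix k \<sigma>n xs) *v y"
  have "dist (posterior_mean k \<sigma>n xs y x) (posterior_mean k \<sigma>n xs y x')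
      = \<bar>(kernel_vector k xs x - kernel_vector k xs x') \<bullet> ?w\<bar>"
    by (simp add: posterior_mean_def dist_real_def inner_diff_left)
  also have "\<dots> \<le> norm (kernel_vector k xs x - kernel_vector k xs x') * norm ?w"
    by (rule Cauchy_Schwarz_ineq2)
  also have "\<dots> \<le> sqrt (real CARD('n)) * (L * dist x x') * norm ?w"
    using \<open>x \<in> X\<close> \<open>x' \<in> X\<close> by (intro mult_right_mono norm_kernel_vector_diff_le[OF lip xs]) auto
  finally show "dist (posterior_mean k \<sigma>n xs y x) (posterior_mean k \<sigma>n xs y x')
      \<le> L * sqrt (real CARD('n)) * norm ?w * dist x x'"
    by (simp add: mult_ac)
next
  have "0 \<le> L"
    using lip xs by (meson lipschitz_on_nonneg)
  then show "0 \<le> L * sqrt (real CARD('n)) * norm (matrix_inv (noisy_kernel_matrix k \<sigma>n xs) *v y)"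
    by simp
qed

text \<open>The diagonal of the kernel contributes the summand 1 in the bracket. In the quadratic
  form the difference of the kernel vectors and each of their norms carry a factor
  \<open>sqrt (real CARD('n))\<close>; two such factors meet in every product.\<close>

lemma posterior_variance_diff_le:
  fixes xs :: "'n::finite \<Rightarrow> 'a::metric_space"
  assumes kernel: "covariance_kernel k"
    and lip: "\<forall>z\<in>X. L-lipschitz_on X (\<lambda>x. k x z)" and xs: "\<And>i. xs i \<in> X"
    and \<kappa>: "\<And>x z. x \<in> X \<Longrightarrow> z \<in> X \<Longrightarrow> k x z \<le> \<kappa>"
    and x: "x \<in> X" "x' \<in> X"
  shows "\<bar>posterior_variance k \<sigma>n xs x - posterior_variance k \<sigma>n xs x'\<bar>
    \<le> 2 * dist x x' * L * (1 + real CARD('n) * onorm ((*v) (matrix_inv (noisy_kernel_matrix k \<sigma>n xs))) * \<kappa>)"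
proof -
  define A where "A = matrix_inv (noisy_kernel_matrix k \<sigma>n xs)"
  define v where "v = kernel_vector k xs"
  have sym: "k z z' = k z' z" and pos: "0 < k z z'" for z z'
    using kernel by (simp_all add: covariance_kernel_def)
  have "0 \<le> L"
    using lip x by (meson lipschitz_on_nonneg)
  have k_diff: "\<bar>k z y - k z' y\<bar> \<le> L * dist z z'" if "z \<in> X" "z' \<in> X" "y \<in> X" for z z' y
    using lip that by (metis dist_real_def lipschitz_onD)
  \<comment> \<open>The two arguments move one after the other; symmetry turns the second move into
    one in the first argument.\<close>
  have diag: "\<bar>k x x - k x' x'\<bar> \<le> 2 * (L * dist x x')"
    using k_diff[of x x' x] k_diff[of x x' x'] sym[of x' x] x by linarith
  have norm_v: "norm (v z) \<le> sqrt (real CARD('n)) * \<kappa>" if "z \<in> X" for z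
    unfolding v_def using \<kappa>[OF that xs] pos
    by (intro norm_le_sqrt_card_mult) (simp add: kernel_vector_def abs_of_pos)
  have "\<bar>v x \<bullet> (A *v v x) - v x' \<bullet> (A *v v x')\<bar>
      \<le> norm (v x - v x') * onorm ((*v) A) * (norm (v x) + norm (v x'))"
    by (rule inner_matrix_bilinear_diff)
  also have "\<dots> \<le> sqrt (real CARD('n)) * (L * dist x x') * onorm ((*v) A) * (2 * (sqrt (real CARD('n)) * \<kappa>))"
    using norm_kernel_vector_diff_le[OF lip xs x] norm_v[OF x(1)] norm_v[OF x(2)] \<open>0 \<le> L\<close>
    by (intro mult_mono mult_right_mono) (auto simp: v_def intro!: mult_nonneg_nonneg onorm_pos_le)
  also have "\<dots> = 2 * (sqrt (real CARD('n)) * sqrt (real CARD('n))) * L * dist x x' * onorm ((*v) A) * \<kappa>"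
    by (simp only: mult_ac)
  also have "sqrt (real CARD('n)) * sqrt (real CARD('n)) = real CARD('n)"
    by simp
  finally have "\<bar>v x \<bullet> (A *v v x) - v x' \<bullet> (A *v v x')\<bar>
      \<le> 2 * real CARD('n) * L * dist x x' * onorm ((*v) A) * \<kappa>" .
  then have "\<bar>posterior_variance k \<sigma>n xs x - posterior_variance k \<sigma>n xs x'\<bar>
      \<le> 2 * (L * dist x x') + 2 * real CARD('n) * L * dist x x' * onorm ((*v) A) * \<kappa>"
    using diag by (simp add: posterior_variance_def flip: A_def v_def)
  then show ?thesis
    by (simp add: algebra_simps flip: A_def)
qed

lemma posterior_sd_modulus:
  fixes xs :: "'n::finite \<Rightarrow> 'a::metric_space"
  assumes "covariance_kernel k" "invertible (noisy_kernel_matrix k \<sigma>n xs)"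
    and "\<forall>z\<in>X. L-lipschitz_on X (\<lambda>x. k x z)" "\<And>i. xs i \<in> X"
    and "\<And>x z. x \<in> X \<Longrightarrow> z \<in> X \<Longrightarrow> k x z \<le> \<kappa>" "x \<in> X" "x' \<in> X"
  shows "\<bar>posterior_sd k \<sigma>n xs x - posterior_sd k \<sigma>n xs x'\<bar> \<le>
    sqrt (2 * dist x x' * L *
      (1 + real CARD('n) * onorm ((*v) (matrix_inv (noisy_kernel_matrix k \<sigma>n xs))) * \<kappa>))"
  unfolding posterior_sd_def
  using abs_sqrt_diff_le[OF posterior_variance_nonneg[OF assms(1,2)] posterior_variance_nonneg[OF assms(1,2)]]
    real_sqrt_le_mono[OF posterior_variance_diff_le[OF assms(1,3-7)]]
  by (rule order_trans)

lemma continuous_on_sqrt_modulus: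
  fixes g :: "'a::metric_space \<Rightarrow> real"
  assumes "\<And>x x'. x \<in> X \<Longrightarrow> x' \<in> X \<Longrightarrow> \<bar>g x - g x'\<bar> \<le> sqrt (c * dist x x')"
  shows "continuous_on X g"
  unfolding continuous_on_def
proof
  fix x assume "x \<in> X"
  have "((\<lambda>x'. sqrt (c * dist x' x)) \<longlongrightarrow> sqrt (c * dist x x)) (at x within X)"
    by (intro tendsto_intros)
  then have "((\<lambda>x'. sqrt (c * dist x' x)) \<longlongrightarrow> 0) (at x within X)"
    by simp
  then have "((\<lambda>x'. g x' - g x) \<longlongrightarrow> 0) (at x within X)"
    by (rule Lim_null_comparison[rotated])
       (use assms \<open>x \<in> X\<close> in \<open>auto simp: eventually_at_filter\<close>)
  then show "(g \<longlongrightarrow> g x) (at x within X)"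
    by (simp add: LIM_zero_iff)
qed

subsection \<open>The uniform error bound\<close>

text \<open>A sublevel set of \<open>g\<close> is closed relative to \<open>X\<close>, hence the
  trace of a closed set \<open>C\<close>; this \<open>C\<close> contains \<open>D\<close>, therefore
  \<open>closure D\<close>, therefore \<open>X\<close>.\<close>

lemma ball_le_of_dense:
  fixes g :: "'a::topological_space \<Rightarrow> real"
  assumes "continuous_on X g" "D \<subseteq> X" "X \<subseteq> closure D" "\<And>x. x \<in> D \<Longrightarrow> g x \<le> c" "x \<in> X"
  shows "g x \<le> c"
proof -
  have "closedin (top_of_set X) (X \<inter> g -` {..c})"
    using assms(1) by (intro continuous_closedin_preimage) auto
  then obtain C where "closed C" and C: "X \<inter> g -` {..c} = X \<inter> C"
    unfolding closedin_closed by blast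
  have "D \<subseteq> C"
    using C assms(2,4) by blast
  then have "closure D \<subseteq> C"
    using \<open>closed C\<close> by (rule closure_minimal)
  then have "x \<in> X \<inter> g -` {..c}"
    using C assms(3,5) by blast
  then show ?thesis
    by simp
qed

text \<open>\<open>LEAST\<close> is informative only if some finite cover exists. Compactness
  provides one by open balls, and closing the balls only enlarges them.\<close>

lemma covering_number_attained:
  fixes S :: "'a::metric_space set"
  assumes "compact S" "0 < \<tau>"
  obtains T where "finite T" "T \<subseteq> S" "card T = covering_number \<tau> S" "S \<subseteq> (\<Union>z\<in>T. cball z \<tau>)"
proof -
  obtain T where "finite T" "T \<subseteq> S" and cover: "S \<subseteq> (\<Union>z\<in>T. ball z \<tau>)"
    using assms compactE_image[of S S "\<lambda>z. ball z \<tau>"] by (metis UN_I centre_in_ball open_ball subsetI)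
  moreover have "S \<subseteq> (\<Union>z\<in>T. cball z \<tau>)"
    using cover by (rule order_trans) (intro SUP_mono' ball_subset_cball)
  ultimately have "\<exists>n T. finite T \<and> T \<subseteq> S \<and> card T = n \<and> S \<subseteq> (\<Union>z\<in>T. cball z \<tau>)"
    by blast
  from LeastI_ex[OF this] show ?thesis
    using that unfolding covering_number_def by blast
qed

text \<open>The event quantifies over possibly uncountably many points; continuity in
  \<open>x\<close> replaces them by a countable dense set. The bound \<open>c\<close> may depend on
  the outcome, which is fixed when \<open>ball_le_of_dense\<close> is applied.\<close>

lemma sets_ball_continuous_le:
  fixes h :: "'b::topological_space \<Rightarrow> 'a \<Rightarrow> real"
  assumes meas: "\<And>x. x \<in> X \<Longrightarrow> h x \<in> borel_measurable M" "c \<in> borel_measurable M"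
    and cont: "\<And>\<omega>. \<omega> \<in> space M \<Longrightarrow> continuous_on X (\<lambda>x. h x \<omega>)"
    and D: "countable D" "D \<subseteq> X" "X \<subseteq> closure D"
  shows "{\<omega> \<in> space M. \<forall>x\<in>X. h x \<omega> \<le> c \<omega>} \<in> sets M"
proof -
  have "{\<omega> \<in> space M. \<forall>x\<in>X. h x \<omega> \<le> c \<omega>} = {\<omega> \<in> space M. \<forall>x\<in>D. h x \<omega> \<le> c \<omega>}"
    using D(2) ball_le_of_dense[OF cont D(2,3)] by blast
  also have "\<dots> \<in> sets M"
    using D meas by (intro sets.sets_Collect_countable_All' borel_measurable_le) auto
  finally show ?thesis .
qed

text \<open>Union bound over the complementary events, each controlled by
  \<open>gaussian_centered_tail\<close>.\<close>

lemma (in prob_space) finite_gaussian_union_bound: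
  assumes "finite T" "\<And>z. z \<in> T \<Longrightarrow> e z \<in> borel_measurable M"
    and "\<And>z. z \<in> T \<Longrightarrow> distr M borel (e z) = gaussian 0 (v z)" "\<And>z. z \<in> T \<Longrightarrow> 0 \<le> v z"
    and "0 \<le> r"
  shows "1 - real (card T) * exp (- r\<^sup>2 / 2) \<le> prob {\<omega> \<in> space M. \<forall>z\<in>T. \<bar>e z \<omega>\<bar> \<le> r * sqrt (v z)}"
proof -
  have bad: "{\<omega> \<in> space M. r * sqrt (v z) < \<bar>e z \<omega>\<bar>} \<in> events" if "z \<in> T" for z
    using assms(2)[OF that] by measurable
  have "prob (\<Union>z\<in>T. {\<omega> \<in> space M. r * sqrt (v z) < \<bar>e z \<omega>\<bar>})
      \<le> (\<Sum>z\<in>T. prob {\<omega> \<in> space M. r * sqrt (v z) < \<bar>e z \<omega>\<bar>})"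
    using assms(1) bad by (intro finite_measure_subadditive_finite) auto
  also have "\<dots> \<le> (\<Sum>z\<in>T. exp (- r\<^sup>2 / 2))"
  proof (rule sum_mono)
    fix z assume z: "z \<in> T"
    have "prob {\<omega> \<in> space M. r * sqrt (v z) < \<bar>e z \<omega>\<bar>}
        = measure (distr M borel (e z)) {t. r * sqrt (v z) < \<bar>t\<bar>}"
      using assms(2)[OF z] by (subst measure_distr) (auto intro!: arg_cong[where f = prob])
    also have "\<dots> \<le> exp (- r\<^sup>2 / 2)"
      unfolding assms(3)[OF z] by (rule gaussian_centered_tail[OF assms(4)[OF z] assms(5)])
    finally show "prob {\<omega> \<in> space M. r * sqrt (v z) < \<bar>e z \<omega>\<bar>} \<le> exp (- r\<^sup>2 / 2)" .
  qed
  also have "\<dots> = real (card T) * exp (- r\<^sup>2 / 2)"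
    by simp
  finally have "1 - real (card T) * exp (- r\<^sup>2 / 2)
      \<le> 1 - prob (\<Union>z\<in>T. {\<omega> \<in> space M. r * sqrt (v z) < \<bar>e z \<omega>\<bar>})"
    by simp
  also have "\<dots> = prob (space M - (\<Union>z\<in>T. {\<omega> \<in> space M. r * sqrt (v z) < \<bar>e z \<omega>\<bar>}))"
    using assms(1) bad by (intro prob_compl[symmetric] sets.finite_UN) auto
  also have "space M - (\<Union>z\<in>T. {\<omega> \<in> space M. r * sqrt (v z) < \<bar>e z \<omega>\<bar>})
      = {\<omega> \<in> space M. \<forall>z\<in>T. \<bar>e z \<omega>\<bar> \<le> r * sqrt (v z)}"
    by (auto simp: not_less)
  finally show ?thesis .
qed

theorem theorem3p1:
  fixes X :: "(real ^ 'd) set"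
    and k :: "real ^ 'd \<Rightarrow> real ^ 'd \<Rightarrow> real"
    and Lk \<sigma>n :: real
    and M :: "'w measure"
    and f :: "real ^ 'd \<Rightarrow> 'w \<Rightarrow> real"
    and Lf :: "'w \<Rightarrow> real"
    and xs :: "'n::finite \<Rightarrow> real ^ 'd"
    and \<epsilon> :: "'n \<Rightarrow> 'w \<Rightarrow> real"
    and y :: "'w \<Rightarrow> real ^ 'n"
  defines "A \<equiv> matrix_inv (noisy_kernel_matrix k \<sigma>n xs)"
    and "\<nu> \<equiv> (\<lambda>\<omega>. posterior_mean k \<sigma>n xs (y \<omega>))"
    and "\<sigma> \<equiv> posterior_sd k \<sigma>n xs"
  assumes "compact X"
    and "covariance_kernel k"
    and "continuous_on UNIV (\<lambda>(x, x'). k x x')"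
    and "\<forall>z\<in>X. Lk-lipschitz_on X (\<lambda>x. k x z)"
    and "prob_space M"
    and "gaussian_process M X (\<lambda>_. 0) k f"
    and "\<forall>\<omega>\<in>space M. continuous_on X (\<lambda>x. f x \<omega>)"
    and "Lf \<in> borel_measurable M"
    and "\<forall>\<omega>\<in>space M. (Lf \<omega>)-lipschitz_on X (\<lambda>x. f x \<omega>)"
    and "\<forall>i. xs i \<in> X"
    and "\<forall>i. \<epsilon> i \<in> borel_measurable M \<and> distr M borel (\<epsilon> i) = gaussian 0 (\<sigma>n\<^sup>2)"
    and "prob_space.indep_vars M (\<lambda>_. borel) \<epsilon> UNIV"
    and "prob_space.indep_set M
           (sets (vimage_algebra (space M) (\<lambda>\<omega>. \<lambda>x\<in>X. f x \<omega>) (\<Pi>\<^sub>M x\<in>X. borel)))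
           (sets (vimage_algebra (space M) (\<lambda>\<omega> i. \<epsilon> i \<omega>) (\<Pi>\<^sub>M i\<in>UNIV. borel)))"
    and "\<forall>\<omega>\<in>space M. \<forall>i. y \<omega> $ i = f (xs i) \<omega> + \<epsilon> i \<omega>"
    and "invertible (noisy_kernel_matrix k \<sigma>n xs)"
  shows "(\<exists>L\<nu> w\<sigma>.
            L\<nu> \<in> borel_measurable M \<and>
            (\<forall>\<omega>\<in>space M.
               continuous_on X (\<nu> \<omega>) \<and>
               (L\<nu> \<omega>)-lipschitz_on X (\<nu> \<omega>) \<and>
               L\<nu> \<omega> \<le> Lk * sqrt (real CARD('n)) * norm (A *v y \<omega>)) \<and>
            continuous_on X \<sigma> \<and>
            mono_on {0..} w\<sigma> \<and>
            admits_modulus X w\<sigma> \<sigma> \<and>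
            (\<forall>\<tau>\<ge>0. w\<sigma> \<tau> \<le>
               sqrt (2 * \<tau> * Lk *
                 (1 + real CARD('n) * onorm ((*v) A) * (SUP (x, x')\<in>X \<times> X. k x x')))))
       \<and> (\<forall>L\<nu> w\<sigma>.
            L\<nu> \<in> borel_measurable M \<and>
            (\<forall>\<omega>\<in>space M. (L\<nu> \<omega>)-lipschitz_on X (\<nu> \<omega>)) \<and>
            mono_on {0..} w\<sigma> \<and>
            admits_modulus X w\<sigma> \<sigma> \<longrightarrow>
            (\<forall>\<delta> \<tau>. 0 < \<delta> \<and> \<delta> < 1 \<and> 0 < \<tau> \<longrightarrow>
               (let \<beta> = 2 * ln (real (covering_number \<tau> X) / \<delta>);
                    \<gamma> = (\<lambda>\<omega>. (L\<nu> \<omega> + Lf \<omega>) * \<tau> + sqrt \<beta> * w\<sigma> \<tau>)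
                in measure M {\<omega>\<in>space M. \<forall>x\<in>X. \<bar>f x \<omega> - \<nu> \<omega> x\<bar> \<le> sqrt \<beta> * \<sigma> x + \<gamma> \<omega>}
                     \<ge> 1 - \<delta>)))"
proof -
  interpret prob_space M
    by fact
  note kernel = \<open>covariance_kernel k\<close>
    and lip = \<open>\<forall>z\<in>X. Lk-lipschitz_on X (\<lambda>x. k x z)\<close>
    and inv = \<open>invertible (noisy_kernel_matrix k \<sigma>n xs)\<close>
    and gp = \<open>gaussian_process M X (\<lambda>_. 0) k f\<close>
    and Lf_lip = \<open>\<forall>\<omega>\<in>space M. (Lf \<omega>)-lipschitz_on X (\<lambda>x. f x \<omega>)\<close>
  have xs: "xs i \<in> X" for i
    using \<open>\<forall>i. xs i \<in> X\<close> ..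
  have y: "y \<omega> $ i = f (xs i) \<omega> + \<epsilon> i \<omega>" if "\<omega> \<in> space M" for \<omega> i
    using \<open>\<forall>\<omega>\<in>space M. \<forall>i. y \<omega> $ i = f (xs i) \<omega> + \<epsilon> i \<omega>\<close> that by simp
  have "X \<noteq> {}"
    using xs by blast
  have \<epsilon>: "\<epsilon> i \<in> borel_measurable M" "distr M borel (\<epsilon> i) = gaussian 0 (\<sigma>n\<^sup>2)" for i
    using \<open>\<forall>i. \<epsilon> i \<in> borel_measurable M \<and> distr M borel (\<epsilon> i) = gaussian 0 (\<sigma>n\<^sup>2)\<close> by auto

  \<comment> \<open>Measurability of the data and of the posterior mean\<close>
  have f_meas: "f x \<in> borel_measurable M" if "x \<in> X" for x
    using gp that by (simp add: gaussian_process_def)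
  have y_meas: "(\<lambda>\<omega>. y \<omega> $ i) \<in> borel_measurable M" for i
    using borel_measurable_add[OF f_meas[OF xs] \<epsilon>(1)] by (simp add: y cong: measurable_cong)
  have Ay_meas: "(\<lambda>\<omega>. (A *v y \<omega>) $ i) \<in> borel_measurable M" for i
    using y_meas by (simp add: matrix_vector_mult_def)
  have \<nu>_meas: "(\<lambda>\<omega>. \<nu> \<omega> x) \<in> borel_measurable M" for x
    using Ay_meas by (simp add: \<nu>_def posterior_mean_def inner_vec_def flip: A_def)

  \<comment> \<open>Lipschitz constant of the mean and modulus of the standard deviation\<close>
  define \<kappa> where "\<kappa> = (SUP (x, x')\<in>X \<times> X. k x x')"
  have k_le: "k x z \<le> \<kappa>" if "x \<in> X" "z \<in> X" for x z
  proof -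
    have "compact ((\<lambda>(x, x'). k x x') ` (X \<times> X))"
      using \<open>continuous_on UNIV (\<lambda>(x, x'). k x x')\<close> \<open>compact X\<close>
      by (intro compact_continuous_image compact_Times) (auto intro: continuous_on_subset)
    then have "bdd_above ((\<lambda>(x, x'). k x x') ` (X \<times> X))"
      by (intro bounded_imp_bdd_above compact_imp_bounded)
    from cSUP_upper[OF _ this, of "(x, z)"] that show ?thesis
      by (simp add: \<kappa>_def)
  qed
  have "0 \<le> Lk"
    using lip \<open>X \<noteq> {}\<close> by (meson ex_in_conv lipschitz_on_nonneg)
  have "0 \<le> \<kappa>"
    using k_le[OF xs xs] kernel by (meson covariance_kernel_def less_imp_le order_trans)
  \<comment> \<open>The claimed upper bound itself serves as the modulus, just as its counterpart
    for the mean serves as \<open>L\<nu>\<close> below.\<close>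
  define w where "w = (\<lambda>\<tau>. sqrt (2 * \<tau> * Lk * (1 + real CARD('n) * onorm ((*v) A) * \<kappa>)))"
  have C_nonneg: "0 \<le> 1 + real CARD('n) * onorm ((*v) A) * \<kappa>"
    using \<open>0 \<le> \<kappa>\<close> by (intro add_nonneg_nonneg mult_nonneg_nonneg onorm_pos_le) auto
  have \<sigma>_w: "\<bar>\<sigma> x - \<sigma> x'\<bar> \<le> w (dist x x')" if "x \<in> X" "x' \<in> X" for x x'
    unfolding \<sigma>_def w_def A_def
    by (rule posterior_sd_modulus[OF kernel inv lip xs k_le that])
  have \<sigma>_cont: "continuous_on X \<sigma>"
  proof (rule continuous_on_sqrt_modulus)
    show "\<bar>\<sigma> x - \<sigma> x'\<bar> \<le> sqrt ((2 * Lk * (1 + real CARD('n) * onorm ((*v) A) * \<kappa>)) * dist x x')"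
      if "x \<in> X" "x' \<in> X" for x x'
      using \<sigma>_w[OF that] by (simp add: w_def mult_ac)
  qed
  have \<nu>_lip: "(Lk * sqrt (real CARD('n)) * norm (A *v y \<omega>))-lipschitz_on X (\<nu> \<omega>)" for \<omega>
    unfolding \<nu>_def A_def by (rule posterior_mean_lipschitz_on[OF lip xs])
  have "(\<lambda>\<omega>. Lk * sqrt (real CARD('n)) * norm (A *v y \<omega>)) \<in> borel_measurable M"
    using Ay_meas by (simp add: norm_vec_def L2_set_def)
  moreover have "mono_on {0..} w"
    using \<open>0 \<le> Lk\<close> C_nonneg by (auto simp: w_def intro!: mono_onI mult_right_mono)
  moreover have "admits_modulus X w \<sigma>"
    using \<sigma>_w \<open>0 \<le> Lk\<close> C_nonneg by (auto simp: admits_modulus_def w_def)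
  moreover have "\<forall>\<tau>\<ge>0. w \<tau> \<le> sqrt (2 * \<tau> * Lk *
      (1 + real CARD('n) * onorm ((*v) A) * (SUP (x, x')\<in>X \<times> X. k x x')))"
    by (simp add: w_def \<kappa>_def)
  ultimately have lipschitz_part: "\<exists>L\<nu> w\<sigma>.
      L\<nu> \<in> borel_measurable M \<and>
      (\<forall>\<omega>\<in>space M.
         continuous_on X (\<nu> \<omega>) \<and>
         (L\<nu> \<omega>)-lipschitz_on X (\<nu> \<omega>) \<and>
         L\<nu> \<omega> \<le> Lk * sqrt (real CARD('n)) * norm (A *v y \<omega>)) \<and>
      continuous_on X \<sigma> \<and>
      mono_on {0..} w\<sigma> \<and>
      admits_modulus X w\<sigma> \<sigma> \<and>
      (\<forall>\<tau>\<ge>0. w\<sigma> \<tau> \<le>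
         sqrt (2 * \<tau> * Lk *
           (1 + real CARD('n) * onorm ((*v) A) * (SUP (x, x')\<in>X \<times> X. k x x'))))"
    using \<nu>_lip lipschitz_on_continuous_on[OF \<nu>_lip] \<sigma>_cont
    by (intro exI[where x = "\<lambda>\<omega>. Lk * sqrt (real CARD('n)) * norm (A *v y \<omega>)"] exI[where x = w]) blast

  \<comment> \<open>Uniform error bound for arbitrary admissible \<open>L\<nu>\<close> and
    \<open>w\<sigma>\<close>\<close>
  have error_bound: "measure M {\<omega>\<in>space M. \<forall>x\<in>X. \<bar>f x \<omega> - \<nu> \<omega> x\<bar> \<le> sqrt \<beta> * \<sigma> x
        + ((L\<nu> \<omega> + Lf \<omega>) * \<tau> + sqrt \<beta> * w\<sigma> \<tau>)} \<ge> 1 - \<delta>"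
    if L\<nu>: "L\<nu> \<in> borel_measurable M" "\<forall>\<omega>\<in>space M. (L\<nu> \<omega>)-lipschitz_on X (\<nu> \<omega>)"
      and w\<sigma>: "mono_on {0..} w\<sigma>" "admits_modulus X w\<sigma> \<sigma>"
      and \<delta>: "0 < \<delta>" "\<delta> < 1" and "0 < \<tau>"
      and \<beta>: "\<beta> = 2 * ln (real (covering_number \<tau> X) / \<delta>)"
    for L\<nu> w\<sigma> \<delta> \<tau> \<beta>
  proof -
    obtain T where T: "finite T" "T \<subseteq> X" "card T = covering_number \<tau> X" "X \<subseteq> (\<Union>z\<in>T. cball z \<tau>)"
      using covering_number_attained[OF \<open>compact X\<close> \<open>0 < \<tau>\<close>] .
    then have "0 < card T"
      using \<open>X \<noteq> {}\<close> by (auto simp: card_gt_0_iff)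
    \<comment> \<open>At least one centre and \<open>\<delta> < 1\<close> keep the logarithm
      nonnegative, so that \<open>sqrt \<beta>\<close> squares back to
      \<open>\<beta>\<close>.\<close>
    have "1 \<le> real (card T) / \<delta>"
      using \<open>0 < card T\<close> \<delta> by (simp add: field_simps)
    then have "0 \<le> \<beta>"
      using \<beta> T(3) by simp
    \<comment> \<open>By the choice of \<open>\<beta>\<close>, \<open>exp (- \<beta> / 2)\<close> is
      \<open>\<delta>\<close> divided by the number of centres, so the union bound loses exactly
      \<open>\<delta>\<close> in total.\<close>
    have "real (card T) * exp (- (sqrt \<beta>)\<^sup>2 / 2) = \<delta>"
      using \<open>0 \<le> \<beta>\<close> \<open>0 < card T\<close> \<delta> by (simp add: \<beta> exp_minus flip: T(3))
    moreover have "1 - real (card T) * exp (- (sqrt \<beta>)\<^sup>2 / 2)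
        \<le> prob {\<omega> \<in> space M. \<forall>z\<in>T. \<bar>f z \<omega> - \<nu> \<omega> z\<bar> \<le> sqrt \<beta> * sqrt (posterior_variance k \<sigma>n xs z)}"
    proof (rule finite_gaussian_union_bound[OF T(1)])
      fix z assume "z \<in> T"
      then have "z \<in> X"
        using T(2) by blast
      show "(\<lambda>\<omega>. f z \<omega> - \<nu> \<omega> z) \<in> borel_measurable M"
        using f_meas[OF \<open>z \<in> X\<close>] \<nu>_meas by simp
      show "distr M borel (\<lambda>\<omega>. f z \<omega> - \<nu> \<omega> z) = gaussian 0 (posterior_variance k \<sigma>n xs z)"
        unfolding \<nu>_def
        by (rule posterior_error_distr[OF kernel gp \<epsilon>]) (use assms y inv xs \<open>z \<in> X\<close> in auto)
      show "0 \<le> posterior_variance k \<sigma>n xs z"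
        by (rule posterior_variance_nonneg[OF kernel inv])
    qed (use \<open>0 \<le> \<beta>\<close> in simp)
    ultimately have "1 - \<delta> \<le> prob {\<omega> \<in> space M. \<forall>z\<in>T. \<bar>f z \<omega> - \<nu> \<omega> z\<bar> \<le> sqrt \<beta> * \<sigma> z}"
      by (simp add: \<sigma>_def posterior_sd_def)
    also have "\<dots> \<le> prob {\<omega>\<in>space M. \<forall>x\<in>X. \<bar>f x \<omega> - \<nu> \<omega> x\<bar> \<le> sqrt \<beta> * \<sigma> x
        + ((L\<nu> \<omega> + Lf \<omega>) * \<tau> + sqrt \<beta> * w\<sigma> \<tau>)}"
    \<comment> \<open>On the event where all centres are good, passing from \<open>x\<close> to a
      nearby centre \<open>z\<close> costs \<open>Lf \<omega> * \<tau>\<close> for \<open>f\<close>,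
      \<open>L\<nu> \<omega> * \<tau>\<close> for the mean, and
      \<open>sqrt \<beta> * w\<sigma> \<tau>\<close> for exchanging \<open>\<sigma> z\<close> with
      \<open>\<sigma> x\<close>.\<close>
    proof (rule finite_measure_mono, intro subsetI CollectI conjI ballI)
      fix \<omega> x
      assume "\<omega> \<in> {\<omega> \<in> space M. \<forall>z\<in>T. \<bar>f z \<omega> - \<nu> \<omega> z\<bar> \<le> sqrt \<beta> * \<sigma> z}" and "x \<in> X"
      then have \<omega>: "\<omega> \<in> space M" and good: "\<And>z. z \<in> T \<Longrightarrow> \<bar>f z \<omega> - \<nu> \<omega> z\<bar> \<le> sqrt \<beta> * \<sigma> z"
        by auto
      obtain z where "z \<in> T" and near: "dist x z \<le> \<tau>"
        using T(4) \<open>x \<in> X\<close> by (force simp: dist_commute)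
      then have "z \<in> X"
        using T(2) by blast
      have step: "\<bar>g x - g z\<bar> \<le> L * \<tau>" if "L-lipschitz_on X g" for g :: "_ \<Rightarrow> real" and L
        using lipschitz_onD[OF that \<open>x \<in> X\<close> \<open>z \<in> X\<close>] lipschitz_on_nonneg[OF that] near
        by (metis dist_real_def mult_left_mono order_trans)
      have "\<bar>\<sigma> x - \<sigma> z\<bar> \<le> w\<sigma> (dist x z)"
        using w\<sigma>(2) \<open>x \<in> X\<close> \<open>z \<in> X\<close> by (simp add: admits_modulus_def)
      \<comment> \<open>The distance to the centre is only bounded by \<open>\<tau>\<close>;
        monotonicity of the modulus bridges the gap.\<close>
      also have "\<dots> \<le> w\<sigma> \<tau>"
        using near \<open>0 < \<tau>\<close> by (intro mono_onD[OF w\<sigma>(1)]) auto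
      finally have "sqrt \<beta> * \<sigma> z \<le> sqrt \<beta> * (\<sigma> x + w\<sigma> \<tau>)"
        using \<open>0 \<le> \<beta>\<close> by (intro mult_left_mono) auto
      moreover have "\<bar>f x \<omega> - f z \<omega>\<bar> \<le> Lf \<omega> * \<tau>"
        using step Lf_lip \<omega> by blast
      moreover have "\<bar>\<nu> \<omega> x - \<nu> \<omega> z\<bar> \<le> L\<nu> \<omega> * \<tau>"
        using step L\<nu>(2) \<omega> by blast
      ultimately show "\<bar>f x \<omega> - \<nu> \<omega> x\<bar> \<le> sqrt \<beta> * \<sigma> x
          + ((L\<nu> \<omega> + Lf \<omega>) * \<tau> + sqrt \<beta> * w\<sigma> \<tau>)"
        using good[OF \<open>z \<in> T\<close>] unfolding distrib_left distrib_right by linarith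
    next
      \<comment> \<open>\<open>finite_measure_mono\<close> also asks that the larger event be
        measurable. Below, the \<open>\<sigma>\<close> term moves to the left so that the right side
        is independent of \<open>x\<close>, as \<open>sets_ball_continuous_le\<close>
        requires.\<close>
      obtain D where D: "countable D" "D \<subseteq> X" "X \<subseteq> closure D"
        using separable by blast
      have "{\<omega>\<in>space M. \<forall>x\<in>X. \<bar>f x \<omega> - \<nu> \<omega> x\<bar> - sqrt \<beta> * \<sigma> x
          \<le> (L\<nu> \<omega> + Lf \<omega>) * \<tau> + sqrt \<beta> * w\<sigma> \<tau>} \<in> sets M"
      proof (rule sets_ball_continuous_le[OF _ _ _ D])
        show "(\<lambda>\<omega>. \<bar>f x \<omega> - \<nu> \<omega> x\<bar> - sqrt \<beta> * \<sigma> x) \<in> borel_measurable M" if "x \<in> X" for x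
          using f_meas[OF that] \<nu>_meas by simp
        show "(\<lambda>\<omega>. (L\<nu> \<omega> + Lf \<omega>) * \<tau> + sqrt \<beta> * w\<sigma> \<tau>) \<in> borel_measurable M"
          using L\<nu>(1) \<open>Lf \<in> borel_measurable M\<close> by simp
        show "continuous_on X (\<lambda>x. \<bar>f x \<omega> - \<nu> \<omega> x\<bar> - sqrt \<beta> * \<sigma> x)" if "\<omega> \<in> space M" for \<omega>
          using that Lf_lip lipschitz_on_continuous_on[OF \<nu>_lip] \<sigma>_cont
          by (intro continuous_intros) (auto intro: lipschitz_on_continuous_on)
      qed
      then show "{\<omega>\<in>space M. \<forall>x\<in>X. \<bar>f x \<omega> - \<nu> \<omega> x\<bar> \<le> sqrt \<beta> * \<sigma> x
          + ((L\<nu> \<omega> + Lf \<omega>) * \<tau> + sqrt \<beta> * w\<sigma> \<tau>)} \<in> sets M"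
        by (simp add: diff_le_eq add.commute)
    qed auto
    finally show ?thesis .
  qed
  show ?thesis
    using lipschitz_part error_bound unfolding Let_def by blast
qed

end
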